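(* Let $n\ge1$, $B\in\mathcal{M}_{n\times n}(\mathbb{R})$, let $(X,d)$ be a complete vector $B$-metric space with $X$ nonempty, let $D$ be a nonempty closed convex subset of a normed space $Y$, and let $N_1\colon X\times D\to X$ and $N_2\colon X\times D\to D$ be two mappings. Assume that the following conditions are satisfied: (i) $N_1(x,\cdot)$ is continuous for every $x\in X$ and there is a matrix $A$ convergent to zero such that $$d(N_1(x,y),N_1(\overline x,y))\le A\,d(x,\overline x)$$ for all $x,\overline x\in X$ and $y\in D$; (ii) either (a) $B$ and $B^{-1}-A$ are inverse-positive; or (b) $B$ is positive and $I-BA$ is inverse-positive; (iii) $N_2$ is continuous and $N_2(X\times D)$ is a relatively compact subset of $Y$. Then there exists $(x^\ast,y^\ast)\in X\times D$ such that $$N_1(x^\ast,y^\ast)=x^\ast,\qquad N_2(x^\ast,y^\ast)=y^\ast.$$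
   Context: Vectors in $\mathbb{R}^n$ are columns; inequalities between vectors (and between matrices of the same size) and convergence of sequences of vectors or matrices are understood componentwise; $\mathbb{R}_+=[0,\infty)$; $I$ is the $n\times n$ identity matrix. For a set $X$ and an arbitrary matrix $B\in\mathcal{M}_{n\times n}(\mathbb{R})$, a vector $B$-metric on $X$ is a mapping $d\colon X\times X\to\mathbb{R}^n_+$ such that for all $u,v,w\in X$: $d(u,v)=0$ if and only if $u=v$; $d(u,v)=d(v,u)$; and $d(u,w)\le B\,(d(u,v)+d(v,w))$. Then $(X,d)$ is called a vector $B$-metric space. A sequence $(x_k)$ converges to $x$ (written $x_k\to x$) if $d(x_k,x)\to 0$; it is Cauchy if $d(x_k,x_p)\to0$ as $k,p\to\infty$; $(X,d)$ is complete if every Cauchy sequence converges to a point of $X$. Continuity is in the sequential sense: $N_1(x,\cdot)$ is continuous if $y_k\to y$ in $D$ (norm convergence in $Y$) implies $d(N_1(x,y_k),N_1(x,y))\to0$; $N_2$ is continuous if $x_k\to x$ in $(X,d)$ and $y_k\to y$ in $D$ imply $N_2(x_k,y_k)\to N_2(x,y)$ in $Y$. A matrix is positive if all its entries are nonnegative; a square real matrix is inverse-positive if it is invertible and its inverse is positive; a positive matrix $M$ is convergent to zero if $M^k\to 0$ as $k\to\infty$ (so a matrix convergent to zero has, by definition, nonnegative entries). *)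

theory Defs
  imports "HOL-Analysis.Analysis"
begin

text \<open>
  On \<^typ>\<open>real ^ 'n\<close> and \<^typ>\<open>real ^ 'n ^ 'n\<close> the library order and topology are the
  componentwise ones. The library's \<open>(*)\<close> and \<open>(^)\<close> on vectors are componentwise as well,
  so powers of a matrix are defined here from \<open>(**)\<close>.
\<close>

primrec mat_power :: "real ^ 'n ^ 'n \<Rightarrow> nat \<Rightarrow> real ^ 'n ^ 'n" where
  "mat_power M 0 = mat 1"
| "mat_power M (Suc k) = M ** mat_power M k"

definition positive_matrix :: "real ^ 'n ^ 'm \<Rightarrow> bool" where
  "positive_matrix M \<longleftrightarrow> 0 \<le> M"

definition inverse_positive :: "real ^ 'n ^ 'n \<Rightarrow> bool" where
  "inverse_positive M \<longleftrightarrow> invertible M \<and> positive_matrix (matrix_inv M)"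

definition convergent_to_zero :: "real ^ 'n ^ 'n \<Rightarrow> bool" where
  "convergent_to_zero M \<longleftrightarrow> positive_matrix M \<and> mat_power M \<longlonglongrightarrow> 0"

definition vector_B_metric ::
  "'x set \<Rightarrow> real ^ 'n ^ 'n \<Rightarrow> ('x \<Rightarrow> 'x \<Rightarrow> real ^ 'n) \<Rightarrow> bool" where
  "vector_B_metric X B d \<longleftrightarrow>
     (\<forall>u\<in>X. \<forall>v\<in>X. 0 \<le> d u v) \<and>
     (\<forall>u\<in>X. \<forall>v\<in>X. d u v = 0 \<longleftrightarrow> u = v) \<and>
     (\<forall>u\<in>X. \<forall>v\<in>X. d u v = d v u) \<and>
     (\<forall>u\<in>X. \<forall>v\<in>X. \<forall>w\<in>X. d u w \<le> B *v (d u v + d v w))"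

definition vconverges :: "('x \<Rightarrow> 'x \<Rightarrow> real ^ 'n) \<Rightarrow> (nat \<Rightarrow> 'x) \<Rightarrow> 'x \<Rightarrow> bool" where
  "vconverges d x a \<longleftrightarrow> (\<lambda>k. d (x k) a) \<longlonglongrightarrow> 0"

definition vCauchy :: "('x \<Rightarrow> 'x \<Rightarrow> real ^ 'n) \<Rightarrow> (nat \<Rightarrow> 'x) \<Rightarrow> bool" where
  "vCauchy d x \<longleftrightarrow> ((\<lambda>(k, p). d (x k) (x p)) \<longlongrightarrow> 0) (sequentially \<times>\<^sub>F sequentially)"

definition vcomplete :: "'x set \<Rightarrow> ('x \<Rightarrow> 'x \<Rightarrow> real ^ 'n) \<Rightarrow> bool" where
  "vcomplete X d \<longleftrightarrow>
     (\<forall>x. (\<forall>k. x k \<in> X) \<and> vCauchy d x \<longrightarrow> (\<exists>a\<in>X. vconverges d x a))"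

definition complete_vector_B_metric_space ::
  "'x set \<Rightarrow> real ^ 'n ^ 'n \<Rightarrow> ('x \<Rightarrow> 'x \<Rightarrow> real ^ 'n) \<Rightarrow> bool" where
  "complete_vector_B_metric_space X B d \<longleftrightarrow> vector_B_metric X B d \<and> vcomplete X d"

text \<open>Continuity is sequential; sequences and limit points range over the given sets only.\<close>

definition vcontinuous_into ::
  "'y::real_normed_vector set \<Rightarrow> ('x \<Rightarrow> 'x \<Rightarrow> real ^ 'n) \<Rightarrow> ('y \<Rightarrow> 'x) \<Rightarrow> bool" where
  "vcontinuous_into D d f \<longleftrightarrow>
     (\<forall>y b. (\<forall>k. y k \<in> D) \<and> b \<in> D \<and> y \<longlonglongrightarrow> b \<longrightarrow> vconverges d (\<lambda>k. f (y k)) (f b))"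

definition vcontinuous_on_prod ::
  "'x set \<Rightarrow> ('x \<Rightarrow> 'x \<Rightarrow> real ^ 'n) \<Rightarrow> 'y::real_normed_vector set \<Rightarrow> ('x \<times> 'y \<Rightarrow> 'y) \<Rightarrow> bool" where
  "vcontinuous_on_prod X d D g \<longleftrightarrow>
     (\<forall>x a y b. (\<forall>k. x k \<in> X) \<and> a \<in> X \<and> vconverges d x a \<and>
                (\<forall>k. y k \<in> D) \<and> b \<in> D \<and> y \<longlonglongrightarrow> b
                \<longrightarrow> (\<lambda>k. g (x k, y k)) \<longlonglongrightarrow> g (a, b))"

definition relatively_compact :: "'y::real_normed_vector set \<Rightarrow> bool" where
  "relatively_compact S \<longleftrightarrow> compact (closure S)"

end

theory Submission
  imports Defs
begin

text \<open>
  For each \<open>y \<in> D\<close> the map \<open>N1 (\<cdot>, y)\<close> has a fixed point \<open>S y\<close>, and a fixed point \<open>y\<close> of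
  \<open>y \<mapsto> N2 (S y, y)\<close> on \<open>D\<close> gives the solution \<open>(S y, y)\<close>. So three things are needed:
  \<open>S\<close> exists, \<open>S\<close> is continuous, and a continuous self-map of a closed convex set with
  relatively compact range has a fixed point (Schauder).

  For the first two, the vector metric is replaced by the scalar \<open>\<rho> u v = \<parallel>d u v\<parallel>\<close>. The norm is
  monotone on nonnegative vectors, so \<open>\<rho>\<close> satisfies the triangle inequality up to a constant
  factor \<open>C\<close> depending on \<open>B\<close>, and it has the same convergent and Cauchy sequences as \<open>d\<close>.
  A single application of \<open>N1 (\<cdot>, y)\<close> need not contract \<open>\<rho>\<close>, but the \<open>k\<close>-th iterate
  contracts it by a factor \<open>\<kappa> k\<close> bounded by the size of \<open>A\<close>'s \<open>k\<close>-th power, hence tending to \<open>0\<close>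
  uniformly in \<open>y\<close>. Going to an iterate \<open>m\<close> with \<open>C\<^sup>2 * \<kappa> m < 1/2\<close> beats the constant in the triangle
  inequality: the term that has to be estimated reappears on the right with factor \<open>1/2\<close> and
  can be absorbed. This gives existence (\<open>fixpoint_if_iterates_contract\<close>) and continuous
  dependence on \<open>y\<close> (\<open>fixpoints_converge\<close>).

  Schauder's theorem is reduced to Brouwer's by projecting onto the convex hull of a finite net.
  The size of that net is a number that depends on the accuracy, so Brouwer's theorem is derived,
  from Kuhn's combinatorial lemma, for cubes whose dimension is a number and not a type.
\<close>

section \<open>Brouwer's theorem for cubes of numerical dimension\<close>

text \<open>
  A point of \<open>[0,1]\<^sup>n\<close> is represented by a sequence of which only the first \<open>n\<close> entries matter; the
  whole Hilbert cube serves as domain for every \<open>n\<close>.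
\<close>

abbreviation hilbert_cube :: "(nat \<Rightarrow> real) set" where
  "hilbert_cube \<equiv> {x. \<forall>i. x i \<in> {0..1}}"

lemma seq_compact_hilbert_cube: "seq_compact hilbert_cube"
proof -
  have "compactin (product_topology (\<lambda>i::nat. euclidean) UNIV) (\<Pi>\<^sub>E i\<in>UNIV. {0..1::real})"
    by (subst compactin_PiE) auto
  moreover have "(\<Pi>\<^sub>E i\<in>UNIV. {0..1::real}) = hilbert_cube"
    by (auto simp: PiE_def Pi_def)
  ultimately have "compact hilbert_cube"
    by (simp add: euclidean_product_topology)
  then show ?thesis
    by (rule compact_imp_seq_compact)
qed

lemma tendsto_componentwise_iff:
  fixes f :: "'c \<Rightarrow> 'a \<Rightarrow> 'b::topological_space"
  shows "(f \<longlongrightarrow> l) F \<longleftrightarrow> (\<forall>i. ((\<lambda>c. f c i) \<longlongrightarrow> l i) F)"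
proof -
  have "(f \<longlongrightarrow> l) F \<longleftrightarrow> limitin (product_topology (\<lambda>i::'a. euclidean) UNIV) f l F"
    by (simp add: euclidean_product_topology)
  then show ?thesis
    by (simp add: limitin_componentwise)
qed

text \<open>
  A grid point is labelled \<open>0\<close> in direction \<open>i\<close> if \<open>G\<close> does not decrease its \<open>i\<close>-th coordinate, and
  \<open>1\<close> if \<open>G\<close> does not increase it. Kuhn's lemma yields, for each mesh, a small cell in which
  every direction has corners of both labels. The cells accumulate at a point, and there
  continuity turns the two labels into \<open>G x i \<ge> x i\<close> and \<open>G x i \<le> x i\<close>.
\<close>

lemma brouwer_fixpoint_cube:
  fixes G :: "(nat \<Rightarrow> real) \<Rightarrow> nat \<Rightarrow> real"
  assumes cont: "\<And>i. i < n \<Longrightarrow> continuous_on hilbert_cube (\<lambda>x. G x i)"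
    and range: "\<And>x i. x \<in> hilbert_cube \<Longrightarrow> i < n \<Longrightarrow> G x i \<in> {0..1}"
  obtains x where "x \<in> hilbert_cube" "\<And>i. i < n \<Longrightarrow> G x i = x i"
proof -
  define pt :: "nat \<Rightarrow> (nat \<Rightarrow> nat) \<Rightarrow> nat \<Rightarrow> real"
    where "pt p q i = (if i < n then real (q i) / real (Suc p) else 0)" for p q i
  \<comment> \<open>On the upper face the label is forced to be \<open>1\<close>, as Kuhn's lemma demands; this is consistent
      with its meaning because \<open>G\<close> maps into the cube.\<close>
  define label :: "nat \<Rightarrow> (nat \<Rightarrow> nat) \<Rightarrow> nat \<Rightarrow> nat"
    where "label p q i = (if q i \<noteq> Suc p \<and> pt p q i \<le> G (pt p q) i then 0 else 1)" for p q i
  have pt_cube: "pt p q \<in> hilbert_cube" if "\<And>i. i < n \<Longrightarrow> q i \<le> Suc p" for p q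
    using that by (auto simp: pt_def divide_le_eq_1 simp flip: of_nat_Suc)
  have "\<exists>q. (\<forall>i<n. q i < Suc p) \<and>
     (\<forall>i<n. \<exists>r s. (\<forall>j<n. q j \<le> r j \<and> r j \<le> q j + 1) \<and> (\<forall>j<n. q j \<le> s j \<and> s j \<le> q j + 1) \<and>
        label p r i = 0 \<and> label p s i = 1)" for p
  proof -
    have 1: "label p q i = 0" if "\<forall>i<n. q i \<le> Suc p" "i < n" "q i = 0" for q i
      using range[OF pt_cube, of q p i] that by (auto simp: label_def pt_def[of _ _ i])
    have 2: "label p q i = 1" if "q i = Suc p" for q i
      using that by (simp add: label_def)
    obtain q where q: "\<forall>i<n. q i < Suc p"
      and rs: "\<forall>i<n. \<exists>r s. (\<forall>j<n. q j \<le> r j \<and> r j \<le> q j + 1) \<and>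
        (\<forall>j<n. q j \<le> s j \<and> s j \<le> q j + 1) \<and> label p r i \<noteq> label p s i"
      by (rule kuhn_lemma[of "Suc p" n "label p"]) (use 1 2 in \<open>auto simp: label_def\<close>)
    have lab: "label p r i = 0 \<or> label p r i = 1" for r i
      by (simp add: label_def)
    have "\<exists>r s. (\<forall>j<n. q j \<le> r j \<and> r j \<le> q j + 1) \<and> (\<forall>j<n. q j \<le> s j \<and> s j \<le> q j + 1) \<and>
        label p r i = 0 \<and> label p s i = 1" if i: "i < n" for i
    proof -
      obtain r s where r: "\<forall>j<n. q j \<le> r j \<and> r j \<le> q j + 1"
        and s: "\<forall>j<n. q j \<le> s j \<and> s j \<le> q j + 1" and "label p r i \<noteq> label p s i"
        using rs i by blast
      then consider "label p r i = 0" "label p s i = 1" | "label p s i = 0" "label p r i = 1"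
        using lab by metis
      then show ?thesis
        using r s by cases blast+
    qed
    then show ?thesis
      using q by blast
  qed
  then obtain q where q: "\<And>p i. i < n \<Longrightarrow> q p i < Suc p"
    and "\<forall>p. \<forall>i<n. \<exists>r s. (\<forall>j<n. q p j \<le> r j \<and> r j \<le> q p j + 1) \<and>
      (\<forall>j<n. q p j \<le> s j \<and> s j \<le> q p j + 1) \<and> label p r i = 0 \<and> label p s i = 1"
    by metis
  then obtain r s where
    r: "\<And>p i j. i < n \<Longrightarrow> j < n \<Longrightarrow> q p j \<le> r p i j \<and> r p i j \<le> q p j + 1"
    and s: "\<And>p i j. i < n \<Longrightarrow> j < n \<Longrightarrow> q p j \<le> s p i j \<and> s p i j \<le> q p j + 1"
    and lr: "\<And>p i. i < n \<Longrightarrow> label p (r p i) i = 0"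
    and ls: "\<And>p i. i < n \<Longrightarrow> label p (s p i) i = 1"
    by metis
  have "\<forall>p. pt p (q p) \<in> hilbert_cube"
    using pt_cube q less_imp_le by metis
  then obtain x \<phi> where x: "x \<in> hilbert_cube" and \<phi>: "strict_mono \<phi>"
    and lim: "((\<lambda>p. pt p (q p)) \<circ> \<phi>) \<longlonglongrightarrow> x"
    by (rule seq_compactE[OF seq_compact_hilbert_cube])
  \<comment> \<open>The corners \<open>t p\<close> of the cells have the same limit as their base points.\<close>
  have near: "(\<lambda>k. pt (\<phi> k) (t (\<phi> k))) \<longlonglongrightarrow> x"
    if t: "\<And>p j. j < n \<Longrightarrow> q p j \<le> t p j \<and> t p j \<le> q p j + 1" for t
    unfolding tendsto_componentwise_iff
  proof
    fix j
    have d: "\<bar>pt p (t p) j - pt p (q p) j\<bar> \<le> 1 / real (Suc p)" for p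
    proof (cases "j < n")
      case True
      have "\<bar>real (t p j) - real (q p j)\<bar> \<le> 1"
        using t[OF True, of p] by linarith
      then show ?thesis
        using True by (simp add: pt_def divide_right_mono abs_divide flip: diff_divide_distrib)
    qed (simp add: pt_def)
    have "(\<lambda>k. 1 / real (Suc (\<phi> k))) \<longlonglongrightarrow> 0"
      using LIMSEQ_subseq_LIMSEQ[OF LIMSEQ_inverse_real_of_nat \<phi>] by (simp add: o_def inverse_eq_divide)
    then have "(\<lambda>k. pt (\<phi> k) (t (\<phi> k)) j - pt (\<phi> k) (q (\<phi> k)) j) \<longlonglongrightarrow> 0"
      by (rule Lim_null_comparison[rotated]) (simp only: real_norm_def d eventually_sequentially, blast)
    moreover have "(\<lambda>k. pt (\<phi> k) (q (\<phi> k)) j) \<longlonglongrightarrow> x j"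
      using lim by (simp add: tendsto_componentwise_iff)
    ultimately show "(\<lambda>k. pt (\<phi> k) (t (\<phi> k)) j) \<longlonglongrightarrow> x j"
      using tendsto_add by fastforce
  qed
  have "G x i = x i" if i: "i < n" for i
  proof -
    have cube: "pt p (t p) \<in> hilbert_cube"
      if t: "\<And>p j. j < n \<Longrightarrow> q p j \<le> t p j \<and> t p j \<le> q p j + 1" for t p
    proof (rule pt_cube)
      show "t p j \<le> Suc p" if "j < n" for j
        using t[OF that, of p] q[OF that, of p] by linarith
    qed
    have r_cube: "pt p (r p i) \<in> hilbert_cube" and s_cube: "pt p (s p i) \<in> hilbert_cube" for p
      using cube[of "\<lambda>p. r p i"] cube[of "\<lambda>p. s p i"] r[OF i] s[OF i] by blast+
    have Gr: "(\<lambda>k. G (pt (\<phi> k) (r (\<phi> k) i)) i) \<longlonglongrightarrow> G x i"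
      by (rule continuous_on_tendsto_compose[OF cont[OF i] near x]) (use r[OF i] r_cube in auto)
    have Gs: "(\<lambda>k. G (pt (\<phi> k) (s (\<phi> k) i)) i) \<longlonglongrightarrow> G x i"
      by (rule continuous_on_tendsto_compose[OF cont[OF i] near x]) (use s[OF i] s_cube in auto)
    have r_lim: "(\<lambda>k. pt (\<phi> k) (r (\<phi> k) i) i) \<longlonglongrightarrow> x i"
      using near[of "\<lambda>p. r p i"] r[OF i] unfolding tendsto_componentwise_iff by blast
    have s_lim: "(\<lambda>k. pt (\<phi> k) (s (\<phi> k) i) i) \<longlonglongrightarrow> x i"
      using near[of "\<lambda>p. s p i"] s[OF i] unfolding tendsto_componentwise_iff by blast
    have "pt p (r p i) i \<le> G (pt p (r p i)) i" for p
      using lr[OF i, of p] by (simp add: label_def split: if_splits)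
    then have "x i \<le> G x i"
      by (intro LIMSEQ_le[OF r_lim Gr]) auto
    moreover have "G (pt p (s p i)) i \<le> pt p (s p i) i" for p
      using ls[OF i, of p] range[OF s_cube[of p] i] i
      by (auto simp: label_def pt_def[of _ _ i] split: if_splits)
    then have "G x i \<le> x i"
      by (intro LIMSEQ_le[OF Gs s_lim]) auto
    ultimately show ?thesis
      by simp
  qed
  then show ?thesis
    using that x by blast
qed

section \<open>Schauder's theorem\<close>

text \<open>
  Take a finite \<open>\<epsilon>\<close>-net \<open>y 0, \<dots>, y (n - 1)\<close> of \<open>K\<close> and weights \<open>w z i\<close> that vanish unless \<open>y i\<close> is
  within \<open>\<epsilon>\<close> of \<open>z\<close>. Normalised, they express a point near \<open>z\<close> as a convex combination of the net.
  Sending coefficients to the combination, then through \<open>f\<close>, then to the weights of the image is a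
  self-map \<open>G\<close> of a cube, and the combination belonging to a fixed point of \<open>G\<close> is moved
  by \<open>f\<close> by less than \<open>\<epsilon>\<close>.
\<close>

lemma schauder_almost_fixpoint:
  fixes f :: "'a::real_normed_vector \<Rightarrow> 'a"
  assumes "convex D" "D \<noteq> {}" and f: "continuous_on D f" and K: "compact K" "K \<subseteq> D"
    and fK: "f ` D \<subseteq> K" and \<epsilon>: "\<epsilon> > 0"
  obtains x where "x \<in> D" "norm (x - f x) < \<epsilon>"
proof -
  obtain S where S: "finite S" "S \<subseteq> K" "K \<subseteq> (\<Union>y\<in>S. ball y \<epsilon>)"
    by (rule compactE_image[OF K(1), of K "\<lambda>y. ball y \<epsilon>"]) (use \<epsilon> in auto)
  have "S \<noteq> {}"
    using S(3) fK \<open>D \<noteq> {}\<close> by auto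
  define n where "n = card S"
  have "n > 0"
    using S(1) \<open>S \<noteq> {}\<close> by (simp add: n_def card_gt_0_iff)
  obtain y where y: "bij_betw y {..<n} S"
    using ex_bij_betw_nat_finite[OF S(1)] by (auto simp: n_def atLeast0LessThan)
  have yD: "y i \<in> D" if "i < n" for i
    using y that S(2) K(2) by (auto simp: bij_betw_def)
  define w where "w z i = max 0 (\<epsilon> - norm (z - y i))" for z i
  define W where "W z = (\<Sum>i<n. w z i)" for z
  have w0: "w z i \<ge> 0" for z i
    by (simp add: w_def)
  have W: "W z > 0" if z: "z \<in> K" for z
  proof -
    obtain u where "u \<in> S" "dist u z < \<epsilon>"
      using z S(3) by auto
    then obtain i where i: "i < n" "dist (y i) z < \<epsilon>"
      using y by (auto simp: bij_betw_def)
    then have "w z i > 0"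
      by (simp add: w_def dist_norm norm_minus_commute)
    then show ?thesis
      unfolding W_def using i(1) w0 by (intro sum_pos2[of _ i]) auto
  qed
  \<comment> \<open>Coefficients in the cube need not have sum \<open>1\<close>: a deficit is assigned to \<open>y 0\<close>, an excess is
      scaled away. For sum \<open>1\<close>, as at fixed points of \<open>G\<close>, \<open>\<phi> l\<close> is the combination itself.\<close>
  define c where "c l = max 1 (\<Sum>i<n. l i)" for l :: "nat \<Rightarrow> real"
  define \<phi> where "\<phi> l = (1 / c l) *\<^sub>R ((\<Sum>i<n. l i *\<^sub>R y i) + (c l - (\<Sum>i<n. l i)) *\<^sub>R y 0)"
    for l :: "nat \<Rightarrow> real"
  have \<phi>D: "\<phi> l \<in> D" if l: "l \<in> hilbert_cube" for l
  proof -
    define v where "v i = (l i + (if i = 0 then c l - (\<Sum>i<n. l i) else 0)) / c l" for i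
    have c: "c l \<ge> 1" "c l \<ge> (\<Sum>i<n. l i)"
      by (auto simp: c_def)
    have "(\<Sum>i<n. v i) = 1"
      using c \<open>n > 0\<close> by (simp add: v_def sum.distrib sum.delta flip: sum_divide_distrib)
    moreover have "v i \<ge> 0" for i
      using l c by (auto simp: v_def intro!: divide_nonneg_nonneg add_nonneg_nonneg)
    ultimately have "(\<Sum>i<n. v i *\<^sub>R y i) \<in> D"
      using yD \<open>convex D\<close> by (intro convex_sum) auto
    also have "(\<Sum>i<n. v i *\<^sub>R y i) =
      (1 / c l) *\<^sub>R (\<Sum>i<n. l i *\<^sub>R y i + (if i = 0 then (c l - (\<Sum>i<n. l i)) *\<^sub>R y i else 0))"
      by (auto simp: v_def scaleR_sum_right scaleR_add_left algebra_simps add_divide_distrib diff_divide_distrib intro!: sum.cong)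
    also have "\<dots> = \<phi> l"
      using \<open>n > 0\<close> by (simp add: \<phi>_def sum.distrib sum.delta)
    finally show ?thesis .
  qed
  have coord: "continuous_on hilbert_cube (\<lambda>l::nat\<Rightarrow>real. l i)" for i
    by (rule continuous_on_subset[OF continuous_on_product_coordinates]) simp
  have "continuous_on hilbert_cube \<phi>"
    unfolding \<phi>_def c_def by (intro continuous_intros coord) (auto simp: max_def)
  then have contf: "continuous_on hilbert_cube (\<lambda>l. f (\<phi> l))"
    using f \<phi>D by (intro continuous_on_compose2[OF f]) auto
  have WK: "W (f (\<phi> l)) > 0" if "l \<in> hilbert_cube" for l
    using W fK \<phi>D[OF that] by blast
  define G where "G l i = w (f (\<phi> l)) i / W (f (\<phi> l))" for l i
  obtain l where l: "l \<in> hilbert_cube" and fp: "\<And>i. i < n \<Longrightarrow> G l i = l i"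
  proof (rule brouwer_fixpoint_cube[of n G])
    show "continuous_on hilbert_cube (\<lambda>l. G l i)" for i
      unfolding G_def
    proof (rule continuous_on_divide)
      show "\<forall>l\<in>hilbert_cube. W (f (\<phi> l)) \<noteq> 0"
        using WK less_imp_neq by metis
    qed (unfold W_def w_def, (intro continuous_intros contf)+)
    show "G l i \<in> {0..1}" if l: "l \<in> hilbert_cube" and i: "i < n" for l i
    proof -
      have "w z i \<le> W z" for z
        unfolding W_def using i w0 by (intro member_le_sum) auto
      then show ?thesis
        using WK[OF l] w0 by (simp add: G_def divide_le_eq_1)
    qed
  qed blast
  define z where "z = f (\<phi> l)"
  have Wz: "W z > 0"
    using WK[OF l] by (simp add: z_def)
  have li: "l i = w z i / W z" if "i < n" for i
    using fp[OF that] by (simp add: G_def z_def)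
  have suml: "(\<Sum>i<n. l i) = 1"
    using Wz by (simp add: li flip: sum_divide_distrib W_def)
  have "\<phi> l = (\<Sum>i<n. l i *\<^sub>R y i)"
    by (simp add: \<phi>_def c_def suml)
  then have "\<phi> l - z = (\<Sum>i<n. l i *\<^sub>R y i) - (\<Sum>i<n. l i) *\<^sub>R z"
    by (simp add: suml)
  also have "\<dots> = (\<Sum>i<n. l i *\<^sub>R (y i - z))"
    by (simp add: scaleR_diff_right sum_subtractf scaleR_sum_left)
  also have "norm \<dots> \<le> (\<Sum>i<n. l i * norm (y i - z))"
    using l by (intro order_trans[OF norm_sum]) (auto intro!: sum_mono)
  also have "\<dots> < (\<Sum>i<n. l i * \<epsilon>)"
  proof (rule sum_strict_mono_ex1)
    have *: "norm (y i - z) < \<epsilon>" if "l i > 0" "i < n" for i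
    proof -
      have "w z i > 0"
        using that li[of i] Wz by (simp add: zero_less_divide_iff)
      then show ?thesis
        by (simp add: w_def norm_minus_commute)
    qed
    have l0: "l i \<ge> 0" for i
      using l by auto
    show "\<forall>i\<in>{..<n}. l i * norm (y i - z) \<le> l i * \<epsilon>"
      using * l0 by (metis lessThan_iff less_eq_real_def mult_left_mono mult_zero_left)
    have "\<exists>i<n. l i > 0"
      using suml l0 by (metis lessThan_iff less_eq_real_def sum.neutral zero_neq_one)
    then show "\<exists>i\<in>{..<n}. l i * norm (y i - z) < l i * \<epsilon>"
      using * by (auto intro!: mult_strict_left_mono)
  qed simp
  also have "\<dots> = \<epsilon>"
    by (simp add: suml flip: sum_distrib_right)
  finally show ?thesis
    using that[OF \<phi>D[OF l]] by (simp add: z_def)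
qed

text \<open>
  The images of approximate fixed points have a limit by compactness; the approximate fixed points
  converge to the same limit, which is therefore fixed.
\<close>

lemma schauder_fixpoint:
  fixes f :: "'a::real_normed_vector \<Rightarrow> 'a"
  assumes D: "convex D" "closed D" "D \<noteq> {}" and f: "continuous_on D f" "f ` D \<subseteq> D"
    and K: "compact (closure (f ` D))"
  obtains x where "x \<in> D" "f x = x"
proof -
  have KD: "closure (f ` D) \<subseteq> D"
    using D f by (simp add: closure_minimal)
  have "\<exists>x\<in>D. norm (x - f x) < inverse (real (Suc k))" for k
    by (rule schauder_almost_fixpoint[OF D(1,3) f(1) K KD closure_subset, of "inverse (real (Suc k))"]) auto
  then obtain x where x: "\<And>k. x k \<in> D" "\<And>k. norm (x k - f (x k)) < inverse (real (Suc k))"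
    by metis
  have "\<forall>k. f (x k) \<in> closure (f ` D)"
    using x(1) closure_subset[of "f ` D"] by blast
  then obtain z r where z: "z \<in> closure (f ` D)" and r: "strict_mono r"
    and lim: "((\<lambda>k. f (x k)) \<circ> r) \<longlonglongrightarrow> z"
    by (rule seq_compactE[OF compact_imp_seq_compact[OF K]])
  have "(\<lambda>k. x k - f (x k)) \<longlonglongrightarrow> 0"
    by (rule Lim_null_comparison[OF _ LIMSEQ_inverse_real_of_nat])
      (use x(2) less_imp_le in \<open>auto intro!: always_eventually\<close>)
  then have "(\<lambda>k. x (r k) - f (x (r k))) \<longlonglongrightarrow> 0"
    using LIMSEQ_subseq_LIMSEQ r by (fastforce simp: o_def)
  then have "(\<lambda>k. x (r k)) \<longlonglongrightarrow> z"
    using tendsto_add[OF _ lim, of "\<lambda>k. x (r k) - f (x (r k))" 0] by (simp add: o_def)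
  then have "(\<lambda>k. f (x (r k))) \<longlonglongrightarrow> f z"
    using z KD x(1) by (intro continuous_on_tendsto_compose[OF f(1)]) auto
  then have "f z = z"
    using lim LIMSEQ_unique by (fastforce simp: o_def)
  then show ?thesis
    using that z KD by blast
qed

section \<open>Fixed points of maps with contracting iterates in b-metric spaces\<close>

lemma tendsto_zero_squeeze:
  fixes f g :: "'b \<Rightarrow> real"
  assumes "\<And>x. f x \<le> g x" "\<And>x. 0 \<le> f x" "(g \<longlongrightarrow> 0) F"
  shows "(f \<longlongrightarrow> 0) F"
  by (rule tendsto_sandwich[OF _ _ tendsto_const assms(3)]) (simp_all add: assms)

locale b_metric =
  fixes X :: "'x set" and \<rho> :: "'x \<Rightarrow> 'x \<Rightarrow> real" and C :: real
  assumes nonneg: "u \<in> X \<Longrightarrow> v \<in> X \<Longrightarrow> 0 \<le> \<rho> u v"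
    and zero_iff: "u \<in> X \<Longrightarrow> v \<in> X \<Longrightarrow> \<rho> u v = 0 \<longleftrightarrow> u = v"
    and commute: "u \<in> X \<Longrightarrow> v \<in> X \<Longrightarrow> \<rho> u v = \<rho> v u"
    and triangle: "u \<in> X \<Longrightarrow> v \<in> X \<Longrightarrow> w \<in> X \<Longrightarrow> \<rho> u w \<le> C * (\<rho> u v + \<rho> v w)"
    and C_nonneg: "0 \<le> C"
begin

lemma funpow_closed: "T \<in> X \<rightarrow> X \<Longrightarrow> u \<in> X \<Longrightarrow> (T ^^ k) u \<in> X"
  by (induction k) auto

text \<open>
  The orbit \<open>x k\<close> of any point satisfies \<open>\<rho> (x k) (x (k + m)) \<rightarrow> 0\<close> for fixed \<open>m\<close>. Going from \<open>x k\<close> to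
  \<open>x p\<close> through \<open>x (k + m)\<close> and \<open>x (p + m)\<close> uses the triangle inequality only twice, whatever
  \<open>k\<close> and \<open>p\<close> are, so the factor \<open>C\<^sup>2\<close> does not accumulate, and a suitable \<open>m\<close> absorbs the
  middle term. Hence the orbit is Cauchy, and its limit is fixed.
\<close>

lemma fixpoint_if_iterates_contract:
  assumes "X \<noteq> {}"
    and complete: "\<And>x. \<lbrakk>\<forall>k. x k \<in> X;
        ((\<lambda>(k, p). \<rho> (x k) (x p)) \<longlongrightarrow> 0) (sequentially \<times>\<^sub>F sequentially)\<rbrakk>
      \<Longrightarrow> \<exists>a\<in>X. (\<lambda>k. \<rho> (x k) a) \<longlonglongrightarrow> 0"
    and T: "T \<in> X \<rightarrow> X"
    and contr: "\<And>k u v. u \<in> X \<Longrightarrow> v \<in> X \<Longrightarrow> \<rho> ((T ^^ k) u) ((T ^^ k) v) \<le> \<kappa> k * \<rho> u v"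
    and \<kappa>: "\<kappa> \<longlonglongrightarrow> 0"
  shows "\<exists>x\<in>X. T x = x"
proof -
  obtain x0 where x0: "x0 \<in> X"
    using \<open>X \<noteq> {}\<close> by blast
  define x where "x k = (T ^^ k) x0" for k
  have x: "x k \<in> X" for k
    using funpow_closed[OF T x0] by (simp add: x_def)
  have shift: "x (k + m) = (T ^^ m) (x k)" for k m
    by (simp add: x_def add.commute[of k m] funpow_add)
  have "(\<lambda>m. C\<^sup>2 * \<kappa> m) \<longlonglongrightarrow> 0"
    using tendsto_mult_right_zero[OF \<kappa>] by simp
  then have "eventually (\<lambda>m. C\<^sup>2 * \<kappa> m < 1/2) sequentially"
    by (rule order_tendstoD) simp
  then obtain m where m: "C\<^sup>2 * \<kappa> m < 1/2"
    by (auto simp: eventually_sequentially)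
  define \<delta> where "\<delta> k = \<rho> (x k) (x (k + m))" for k
  have "\<delta> k \<le> \<kappa> k * \<rho> x0 (x m)" for k
    using contr[OF x0 x[of m], of k] by (simp add: \<delta>_def x_def funpow_add)
  moreover have "0 \<le> \<delta> k" for k
    using nonneg x by (simp add: \<delta>_def)
  moreover have "(\<lambda>k. \<kappa> k * \<rho> x0 (x m)) \<longlonglongrightarrow> 0"
    using \<kappa> by (rule tendsto_mult_left_zero)
  ultimately have \<delta>: "\<delta> \<longlonglongrightarrow> 0"
    by (rule tendsto_zero_squeeze)
  have bound: "\<rho> (x k) (x p) \<le> 2 * (C * \<delta> k + C\<^sup>2 * \<delta> p)" for k p
  proof -
    have "\<rho> (x (k + m)) (x (p + m)) \<le> \<kappa> m * \<rho> (x k) (x p)"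
      using contr[OF x[of k] x[of p], of m] by (simp add: shift)
    then have "C\<^sup>2 * \<rho> (x (k + m)) (x (p + m)) \<le> (C\<^sup>2 * \<kappa> m) * \<rho> (x k) (x p)"
      by (simp add: mult.assoc mult_left_mono)
    also have "\<dots> \<le> 1/2 * \<rho> (x k) (x p)"
      using m nonneg x by (intro mult_right_mono) auto
    finally have 1: "C\<^sup>2 * \<rho> (x (k + m)) (x (p + m)) \<le> 1/2 * \<rho> (x k) (x p)" .
    have "\<rho> (x k) (x p) \<le> C * (\<delta> k + \<rho> (x (k + m)) (x p))"
      unfolding \<delta>_def using triangle x by blast
    also have "\<dots> \<le> C * (\<delta> k + C * (\<rho> (x (k + m)) (x (p + m)) + \<delta> p))"
      using triangle[of "x (k + m)" "x (p + m)" "x p"] commute[of "x (p + m)" "x p"] x C_nonneg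
      by (intro mult_left_mono add_left_mono) (auto simp: \<delta>_def)
    also have "\<dots> = C * \<delta> k + C\<^sup>2 * \<delta> p + C\<^sup>2 * \<rho> (x (k + m)) (x (p + m))"
      by (simp add: power2_eq_square algebra_simps)
    finally show ?thesis
      using 1 by simp
  qed
  have "((\<lambda>(k, p). \<rho> (x k) (x p)) \<longlongrightarrow> 0) (sequentially \<times>\<^sub>F sequentially)"
  proof (rule tendsto_zero_squeeze)
    have "((\<lambda>z. 2 * (C * \<delta> (fst z) + C\<^sup>2 * \<delta> (snd z))) \<longlongrightarrow> 2 * (C * 0 + C\<^sup>2 * 0))
        (sequentially \<times>\<^sub>F sequentially)"
      by (intro tendsto_intros filterlim_compose[OF \<delta>] filterlim_fst filterlim_snd)
    then show "((\<lambda>(k, p). 2 * (C * \<delta> k + C\<^sup>2 * \<delta> p)) \<longlongrightarrow> 0) (sequentially \<times>\<^sub>F sequentially)"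
      by (simp add: case_prod_beta')
  qed (use nonneg x bound in auto)
  then obtain a where a: "a \<in> X" and lim: "(\<lambda>k. \<rho> (x k) a) \<longlonglongrightarrow> 0"
    using complete x by blast
  have Ta: "T a \<in> X"
    using T a by blast
  have "\<rho> a (T a) \<le> C * (\<rho> (x (Suc k)) a + \<kappa> 1 * \<rho> (x k) a)" for k
  proof -
    have "\<rho> (x (Suc k)) (T a) \<le> \<kappa> 1 * \<rho> (x k) a"
      using contr[OF x[of k] a, of 1] by (simp add: x_def)
    then have "C * (\<rho> a (x (Suc k)) + \<rho> (x (Suc k)) (T a)) \<le> C * (\<rho> (x (Suc k)) a + \<kappa> 1 * \<rho> (x k) a)"
      using C_nonneg commute[OF a x[of "Suc k"]] by (intro mult_left_mono) auto
    then show ?thesis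
      using triangle[OF a x[of "Suc k"] Ta] by linarith
  qed
  moreover have "(\<lambda>k. C * (\<rho> (x (Suc k)) a + \<kappa> 1 * \<rho> (x k) a)) \<longlonglongrightarrow> C * (0 + \<kappa> 1 * 0)"
    by (intro tendsto_intros lim LIMSEQ_Suc)
  ultimately have "\<rho> a (T a) \<le> 0"
    by (intro LIMSEQ_le_const) auto
  then have "\<rho> a (T a) = 0"
    using nonneg[OF a Ta] by simp
  then have "a = T a"
    using zero_iff[OF a Ta] by simp
  then show ?thesis
    using a by metis
qed

text \<open>
  The fixed points of a family of maps depend continuously on the parameter, if the maps contract
  uniformly. Since \<open>x k\<close> is also fixed by \<open>T k ^^ m\<close>, comparing it with \<open>(T k ^^ m) a\<close>
  bounds \<open>\<rho> (x k) a\<close> by a multiple of \<open>\<rho> ((T k ^^ m) a) a\<close>; and iterates of \<open>T k\<close> move \<open>a\<close> only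
  slightly because \<open>T k\<close> does.
\<close>

lemma fixpoints_converge:
  assumes T: "\<And>k. T k \<in> X \<rightarrow> X"
    and contr: "\<And>k j u v. u \<in> X \<Longrightarrow> v \<in> X \<Longrightarrow> \<rho> ((T k ^^ j) u) ((T k ^^ j) v) \<le> \<kappa> j * \<rho> u v"
    and \<kappa>: "\<kappa> \<longlonglongrightarrow> 0"
    and x: "\<And>k. x k \<in> X" "\<And>k. T k (x k) = x k"
    and a: "a \<in> X" and lim: "(\<lambda>k. \<rho> (T k a) a) \<longlonglongrightarrow> 0"
  shows "(\<lambda>k. \<rho> (x k) a) \<longlonglongrightarrow> 0"
proof -
  have Ta: "(T k ^^ j) a \<in> X" for k j
    by (rule funpow_closed[OF T a])
  have iter_lim: "(\<lambda>k. \<rho> ((T k ^^ j) a) a) \<longlonglongrightarrow> 0" for j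
  proof (induction j)
    case 0
    then show ?case
      using zero_iff[OF a a] by simp
  next
    case (Suc j)
    have "\<rho> ((T k ^^ Suc j) a) a \<le> C * (\<kappa> 1 * \<rho> ((T k ^^ j) a) a + \<rho> (T k a) a)" for k
    proof -
      have "\<rho> ((T k ^^ Suc j) a) (T k a) \<le> \<kappa> 1 * \<rho> ((T k ^^ j) a) a"
        using contr[OF Ta[where k = k and j = j] a, where k = k and j = 1] by simp
      then have "C * (\<rho> ((T k ^^ Suc j) a) (T k a) + \<rho> (T k a) a)
          \<le> C * (\<kappa> 1 * \<rho> ((T k ^^ j) a) a + \<rho> (T k a) a)"
        using C_nonneg by (intro mult_left_mono) auto
      then show ?thesis
        using triangle[OF Ta[where j = "Suc j" and k = k] Ta[where j = 1 and k = k] a] by simp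
    qed
    moreover have "(\<lambda>k. C * (\<kappa> 1 * \<rho> ((T k ^^ j) a) a + \<rho> (T k a) a)) \<longlonglongrightarrow> 0"
    proof -
      have "(\<lambda>k. C * (\<kappa> 1 * \<rho> ((T k ^^ j) a) a + \<rho> (T k a) a)) \<longlonglongrightarrow> C * (\<kappa> 1 * 0 + 0)"
        by (intro tendsto_intros Suc.IH lim)
      then show ?thesis
        by simp
    qed
    ultimately show ?case
      by (rule tendsto_zero_squeeze[OF _ nonneg[OF Ta a]])
  qed
  have "(\<lambda>m. C * \<kappa> m) \<longlonglongrightarrow> 0"
    using tendsto_mult_right_zero[OF \<kappa>] by simp
  then have "eventually (\<lambda>m. C * \<kappa> m < 1/2) sequentially"
    by (rule order_tendstoD) simp
  then obtain m where m: "C * \<kappa> m < 1/2"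
    by (auto simp: eventually_sequentially)
  have "\<rho> (x k) a \<le> 2 * C * \<rho> ((T k ^^ m) a) a" for k
  proof -
    have fix_iter: "(T k ^^ m) (x k) = x k"
      using x(2) by (induction m) auto
    have "C * \<rho> (x k) ((T k ^^ m) a) \<le> (C * \<kappa> m) * \<rho> (x k) a"
      using contr[OF x(1)[of k] a, where k = k and j = m] C_nonneg
      by (simp add: fix_iter mult.assoc mult_left_mono)
    also have "\<dots> \<le> 1/2 * \<rho> (x k) a"
      using m nonneg x(1) a by (intro mult_right_mono) auto
    finally show ?thesis
      using triangle[OF x(1) Ta a, of k m k] by (simp add: algebra_simps)
  qed
  moreover have "(\<lambda>k. 2 * C * \<rho> ((T k ^^ m) a) a) \<longlonglongrightarrow> 0"
    by (rule tendsto_mult_right_zero[OF iter_lim])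
  ultimately show ?thesis
    by (rule tendsto_zero_squeeze[OF _ nonneg[OF x(1) a]])
qed

end

section \<open>From vector metrics to scalar b-metrics\<close>

text \<open>
  A bound for the operator norm that visibly tends to \<open>0\<close> when the entries do.
\<close>

definition entry_sum :: "real ^ 'n ^ 'm \<Rightarrow> real" where
  "entry_sum M = (\<Sum>i\<in>UNIV. \<Sum>j\<in>UNIV. \<bar>M $ i $ j\<bar>)"

lemma entry_sum_nonneg: "0 \<le> entry_sum M"
  by (simp add: entry_sum_def sum_nonneg)

lemma norm_matrix_vector_mult_le: "norm (M *v x) \<le> entry_sum M * norm x"
proof -
  have "norm (M *v x) \<le> onorm ((*v) M) * norm x"
    by (rule onorm) (simp add: matrix_vector_mul_bounded_linear)
  also have "\<dots> \<le> entry_sum M * norm x"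
    unfolding entry_sum_def by (intro mult_right_mono onorm_le_matrix_component_sum) simp
  finally show ?thesis .
qed

lemma norm_mono_vec:
  fixes u v :: "real ^ 'n"
  assumes "0 \<le> u" "u \<le> v"
  shows "norm u \<le> norm v"
proof (rule norm_le_componentwise_cart)
  fix i
  have "0 \<le> u $ i" "u $ i \<le> v $ i"
    using assms by (auto simp: less_eq_vec_def)
  then show "norm (u $ i) \<le> norm (v $ i)"
    by simp
qed

lemma matrix_vector_mult_mono:
  fixes M :: "real ^ 'n ^ 'm"
  assumes "0 \<le> M" "u \<le> v"
  shows "M *v u \<le> M *v v"
  using assms
  by (auto simp: less_eq_vec_def matrix_vector_mult_def intro!: sum_mono mult_left_mono)

text \<open>
  The vector \<open>B *v (d u v + d v w)\<close> dominates the nonnegative vector \<open>d u w\<close>, so the monotonicity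
  of the norm passes the vector triangle inequality on to norms.
\<close>

lemma b_metric_norm:
  assumes "vector_B_metric X B d"
  shows "b_metric X (\<lambda>u v. norm (d u v)) (entry_sum B)"
proof
  fix u v w assume X: "u \<in> X" "v \<in> X" "w \<in> X"
  have "0 \<le> d u w" "d u w \<le> B *v (d u v + d v w)"
    using assms X by (auto simp: vector_B_metric_def)
  then have "norm (d u w) \<le> norm (B *v (d u v + d v w))"
    by (rule norm_mono_vec)
  also have "\<dots> \<le> entry_sum B * norm (d u v + d v w)"
    by (rule norm_matrix_vector_mult_le)
  also have "\<dots> \<le> entry_sum B * (norm (d u v) + norm (d v w))"
    by (intro mult_left_mono norm_triangle_ineq entry_sum_nonneg)
  finally show "norm (d u w) \<le> entry_sum B * (norm (d u v) + norm (d v w))" .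
qed (use assms in \<open>auto simp: vector_B_metric_def entry_sum_nonneg\<close>)

lemma iterates_matrix_contraction:
  assumes d: "vector_B_metric X B d" and T: "T \<in> X \<rightarrow> X" and A: "0 \<le> A"
    and contr: "\<And>u v. u \<in> X \<Longrightarrow> v \<in> X \<Longrightarrow> d (T u) (T v) \<le> A *v d u v"
    and X: "u \<in> X" "v \<in> X"
  shows "norm (d ((T ^^ k) u) ((T ^^ k) v)) \<le> entry_sum (mat_power A k) * norm (d u v)"
proof -
  have closed: "(T ^^ k) u \<in> X \<and> (T ^^ k) v \<in> X" for k
    using T X by (induction k) auto
  have "d ((T ^^ k) u) ((T ^^ k) v) \<le> mat_power A k *v d u v"
  proof (induction k)
    case (Suc k)
    have "d ((T ^^ Suc k) u) ((T ^^ Suc k) v) \<le> A *v d ((T ^^ k) u) ((T ^^ k) v)"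
      using contr closed by simp
    also have "\<dots> \<le> A *v (mat_power A k *v d u v)"
      by (rule matrix_vector_mult_mono[OF A Suc.IH])
    finally show ?case
      by (simp add: matrix_vector_mul_assoc)
  qed simp
  moreover have "0 \<le> d ((T ^^ k) u) ((T ^^ k) v)"
    using d closed by (auto simp: vector_B_metric_def)
  ultimately show ?thesis
    by (meson norm_mono_vec norm_matrix_vector_mult_le order_trans)
qed

lemma entry_sum_powers_tendsto_zero:
  assumes "convergent_to_zero A"
  shows "(\<lambda>k. entry_sum (mat_power A k)) \<longlonglongrightarrow> 0"
proof -
  have "(\<lambda>k. entry_sum (mat_power A k)) \<longlonglongrightarrow> (\<Sum>i\<in>UNIV. \<Sum>j\<in>UNIV. \<bar>(0 :: real^'a^'a) $ i $ j\<bar>)"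
    unfolding entry_sum_def using assms
    by (intro tendsto_intros) (simp add: convergent_to_zero_def)
  then show ?thesis
    by simp
qed

section \<open>The coupled fixed point theorem\<close>

theorem theorem3p8:
  fixes X :: "'x set"
    and d :: "'x \<Rightarrow> 'x \<Rightarrow> real ^ 'n"
    and A B :: "real ^ 'n ^ 'n"
    and D :: "'y::real_normed_vector set"
    and N1 :: "'x \<times> 'y \<Rightarrow> 'x"
    and N2 :: "'x \<times> 'y \<Rightarrow> 'y"
  assumes "complete_vector_B_metric_space X B d" and "X \<noteq> {}"
    and "D \<noteq> {}" and "closed D" and "convex D"
    and "N1 \<in> X \<times> D \<rightarrow> X" and "N2 \<in> X \<times> D \<rightarrow> D"
    and "\<forall>x\<in>X. vcontinuous_into D d (\<lambda>y. N1 (x, y))"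
    and "convergent_to_zero A"
    and "\<forall>x\<in>X. \<forall>x'\<in>X. \<forall>y\<in>D. d (N1 (x, y)) (N1 (x', y)) \<le> A *v d x x'"
    and "(inverse_positive B \<and> inverse_positive (matrix_inv B - A)) \<or>
         (positive_matrix B \<and> inverse_positive (mat 1 - B ** A))"
    and "vcontinuous_on_prod X d D N2"
    and "relatively_compact (N2 ` (X \<times> D))"
  shows "\<exists>x\<in>X. \<exists>y\<in>D. N1 (x, y) = x \<and> N2 (x, y) = y"
proof -
  have d: "vector_B_metric X B d" and complete: "vcomplete X d"
    using assms(1) by (auto simp: complete_vector_B_metric_space_def)
  interpret b_metric X "\<lambda>u v. norm (d u v)" "entry_sum B"
    by (rule b_metric_norm[OF d])
  have T: "(\<lambda>x. N1 (x, y)) \<in> X \<rightarrow> X" if "y \<in> D" for y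
    using assms(6) that by blast
  have contr: "norm (d (((\<lambda>x. N1 (x, y)) ^^ k) u) (((\<lambda>x. N1 (x, y)) ^^ k) v))
      \<le> entry_sum (mat_power A k) * norm (d u v)" if "y \<in> D" "u \<in> X" "v \<in> X" for y k u v
    using assms(9,10) that
    by (intro iterates_matrix_contraction[OF d T])
      (auto simp: convergent_to_zero_def positive_matrix_def)
  note \<kappa> = entry_sum_powers_tendsto_zero[OF assms(9)]
  have "\<exists>x\<in>X. N1 (x, y) = x" if y: "y \<in> D" for y
  proof (rule fixpoint_if_iterates_contract[OF assms(2) _ T[OF y] contr[OF y] \<kappa>])
    fix x assume x: "\<forall>k. x k \<in> X"
      and "((\<lambda>(k, p). norm (d (x k) (x p))) \<longlongrightarrow> 0) (sequentially \<times>\<^sub>F sequentially)"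
    then have "vCauchy d x"
      unfolding vCauchy_def by (subst tendsto_norm_zero_iff[symmetric]) (simp add: case_prod_beta')
    then show "\<exists>a\<in>X. (\<lambda>k. norm (d (x k) a)) \<longlonglongrightarrow> 0"
      using complete x by (auto simp: vcomplete_def vconverges_def tendsto_norm_zero_iff)
  qed
  then obtain S where S: "\<And>y. y \<in> D \<Longrightarrow> S y \<in> X" "\<And>y. y \<in> D \<Longrightarrow> N1 (S y, y) = S y"
    by metis
  have S_cont: "vconverges d (\<lambda>k. S (y k)) (S b)"
    if y: "\<And>k. y k \<in> D" and b: "b \<in> D" and lim: "y \<longlonglongrightarrow> b" for y b
  proof -
    have "vconverges d (\<lambda>k. N1 (S b, y k)) (N1 (S b, b))"
      using assms(8) S(1)[OF b] y b lim unfolding vcontinuous_into_def by blast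
    then have start: "(\<lambda>k. norm (d (N1 (S b, y k)) (S b))) \<longlonglongrightarrow> 0"
      by (simp add: vconverges_def S(2)[OF b] tendsto_norm_zero_iff)
    have "(\<lambda>k. norm (d (S (y k)) (S b))) \<longlonglongrightarrow> 0"
      by (rule fixpoints_converge[where T = "\<lambda>k x. N1 (x, y k)",
            OF T[OF y] contr[OF y] \<kappa> S(1)[OF y] S(2)[OF y] S(1)[OF b] start])
    then show ?thesis
      by (simp add: vconverges_def tendsto_norm_zero_iff)
  qed
  define f where "f y = N2 (S y, y)" for y
  have "continuous_on D f"
    unfolding continuous_on_sequentially
  proof safe
    fix y b assume y: "\<forall>k. y k \<in> D" "b \<in> D" "y \<longlonglongrightarrow> b"
    then have "\<forall>k. S (y k) \<in> X" "S b \<in> X" "vconverges d (\<lambda>k. S (y k)) (S b)"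
      using S(1) S_cont by auto
    then have "(\<lambda>k. N2 (S (y k), y k)) \<longlonglongrightarrow> N2 (S b, b)"
      using assms(12)[unfolded vcontinuous_on_prod_def, rule_format,
          of "\<lambda>k. S (y k)" "S b" y b] y by simp
    then show "(f \<circ> y) \<longlonglongrightarrow> f b"
      by (simp add: f_def o_def)
  qed
  moreover have "f ` D \<subseteq> D"
    using assms(7) S(1) by (auto simp: f_def)
  moreover have "compact (closure (f ` D))"
  proof -
    have "f ` D \<subseteq> N2 ` (X \<times> D)"
      using S(1) by (auto simp: f_def)
    then have "closure (N2 ` (X \<times> D)) \<inter> closure (f ` D) = closure (f ` D)"
      using closure_mono by blast
    then show ?thesis
      using assms(13) compact_Int_closed[OF _ closed_closure] unfolding relatively_compact_def
      by metis
  qed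
  ultimately obtain y where "y \<in> D" "f y = y"
    by (rule schauder_fixpoint[OF assms(5,4,3)])
  then show ?thesis
    using S by (auto simp: f_def)
qed

end
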